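(* Let $n\ge 3$ be an integer and let $T_n$ be the $n$-dimensional regular simplex with unit edges in $\mathbb{E}^n$. Then $$\theta^l(T_n)\ge 1+\frac{1}{2^{3n+7}}.$$
   Context: $\mathbb{E}^n$ is $n$-dimensional Euclidean space and $\mathrm{vol}$ is $n$-dimensional volume. A lattice $\Lambda\subset\mathbb{E}^n$ is a full-rank lattice (the set of integer combinations of $n$ linearly independent vectors), with determinant $\det(\Lambda)>0$ (the volume of a fundamental parallelepiped). For a convex body $K\subset\mathbb{E}^n$, $K+\Lambda$ denotes the family of translates $K+\mathbf{u}$, $\mathbf{u}\in\Lambda$; it is a (lattice) covering of $\mathbb{E}^n$ if $\bigcup_{\mathbf{u}\in\Lambda}(K+\mathbf{u})=\mathbb{E}^n$. Let $\mathcal{L}$ be the family of all lattices $\Lambda$ such that $K+\Lambda$ is a covering of $\mathbb{E}^n$. The lattice covering density of $K$ is $$\theta^l(K)=\min_{\Lambda\in\mathcal{L}}\frac{\mathrm{vol}(K)}{\det(\Lambda)}.$$ *)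

theory Defs
  imports "HOL-Analysis.Analysis"
begin

definition lattice_basis :: "(real ^ 'n) set \<Rightarrow> (real ^ 'n) set \<Rightarrow> bool"
  where "lattice_basis B L \<longleftrightarrow>
    independent B \<and> card B = CARD('n) \<and>
    L = {(\<Sum>b\<in>B. of_int (z b) *\<^sub>R b) | z :: real ^ 'n \<Rightarrow> int. True}"

definition is_lattice :: "(real ^ 'n) set \<Rightarrow> bool"
  where "is_lattice L \<longleftrightarrow> (\<exists>B. lattice_basis B L)"

definition fundamental_parallelepiped :: "(real ^ 'n) set \<Rightarrow> (real ^ 'n) set"
  where "fundamental_parallelepiped B =
    {(\<Sum>b\<in>B. t b *\<^sub>R b) | t :: real ^ 'n \<Rightarrow> real. \<forall>b\<in>B. 0 \<le> t b \<and> t b < 1}"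

(* The volume is the same for every basis of L, since two bases of a lattice differ by
   a unimodular matrix; hence the choice made by SOME does not matter. *)
definition lattice_det :: "(real ^ 'n) set \<Rightarrow> real"
  where "lattice_det L =
    measure lebesgue (fundamental_parallelepiped (SOME B. lattice_basis B L))"

definition is_lattice_covering :: "(real ^ 'n) set \<Rightarrow> (real ^ 'n) set \<Rightarrow> bool"
  where "is_lattice_covering K L \<longleftrightarrow> is_lattice L \<and> (\<Union>u\<in>L. (\<lambda>x. x + u) ` K) = UNIV"

definition lattice_covering_densities :: "(real ^ 'n) set \<Rightarrow> real set"
  where "lattice_covering_densities K =
    {measure lebesgue K / lattice_det L | L. is_lattice_covering K L}"

(* For a convex body K the infimum is attained, so it is the minimum over all covering
   lattices; see lattice_covering_density_eq_minimum. *)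
definition lattice_covering_density :: "(real ^ 'n) set \<Rightarrow> real"
  where "lattice_covering_density K = Inf (lattice_covering_densities K)"

lemma lattice_covering_density_eq_minimum:
  assumes "m \<in> lattice_covering_densities K"
    and "\<And>d. d \<in> lattice_covering_densities K \<Longrightarrow> m \<le> d"
  shows "lattice_covering_density K = m"
  unfolding lattice_covering_density_def using assms by (rule cInf_eq_minimum)

(* A simplex in the sense of Polytope.simplex, of full dimension, all of whose edges
   have length 1. *)
definition is_unit_regular_simplex :: "(real ^ 'n) set \<Rightarrow> bool"
  where "is_unit_regular_simplex T \<longleftrightarrow>
    (\<exists>C. \<not> affine_dependent C \<and> card C = CARD('n) + 1 \<and>
         pairwise (\<lambda>x y. dist x y = 1) C \<and> T = convex hull C)"

end

theory Submission
  imports Defs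
begin

text \<open>
  Write \<open>T = v + g(\<Delta>)\<close> with \<open>\<Delta>\<close> the standard simplex and \<open>g\<close> linear, and let \<open>T + \<Lambda>\<close> be a covering.
  For \<open>u \<in> \<Lambda>\<close>, \<open>u \<noteq> 0\<close>, the set \<open>T - (T + u)\<close> still covers modulo \<open>\<Lambda>\<close>, hence
  \<open>vol (T \<inter> (T + u)) \<le> vol T - det \<Lambda>\<close>. If \<open>u = g x\<close> with \<open>x \<in> s(\<Delta> - \<Delta>)\<close>, then \<open>T \<inter> (T + u)\<close> contains a
  translate of \<open>(1 - s)T\<close>. So if the density were smaller than \<open>1 + 1/8\<^sup>n\<close>, no nonzero lattice point would
  lie in \<open>7/8 g(\<Delta> - \<Delta>)\<close>, that is, \<open>7/16 g(\<Delta> - \<Delta>)\<close> would be a lattice packing. But the difference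
  body of a simplex has volume \<open>(2n choose n) vol T\<close>, and \<open>(7/16)\<^sup>n (2n choose n) > 1\<close> for \<open>n \<ge> 3\<close>, so
  this packing would have larger volume than the covering set \<open>T\<close>.
\<close>

section \<open>Volume of linear images\<close>

lemma emeasure_lborel_translate:
  fixes A :: "'a::euclidean_space set"
  assumes [measurable]: "A \<in> sets borel"
  shows "(\<lambda>x. x + a) ` A \<in> sets borel" "emeasure lborel ((\<lambda>x. x + a) ` A) = emeasure lborel A"
proof -
  have eq: "(+) (- a) -` A = (\<lambda>x. x + a) ` A"
    by (auto simp: image_iff algebra_simps intro!: bexI[of _ "_ - a"])
  have "(+) (- a) -` A \<in> sets borel"
    using measurable_sets[of "(+) (- a)" borel borel A] by simp
  then show "(\<lambda>x. x + a) ` A \<in> sets borel" by (simp add: eq)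
  have "emeasure lborel A = emeasure (distr lborel borel ((+) (- a))) A"
    by (simp add: lborel_distr_plus)
  also have "\<dots> = emeasure lborel ((+) (- a) -` A)"
    by (subst emeasure_distr) auto
  finally show "emeasure lborel ((\<lambda>x. x + a) ` A) = emeasure lborel A" by (simp add: eq)
qed

text \<open>The indicator of a union is at most the sum of the indicators. Writing the sum as an
  integral over \<open>count_space I\<close> matches \<open>emeasure_UN_countable\<close>, so the
  lattice need not be enumerated.\<close>

lemma emeasure_UN_le_nn_integral:
  assumes "countable I" and [measurable]: "\<And>i. i \<in> I \<Longrightarrow> f i \<in> sets M"
  shows "emeasure M (\<Union>i\<in>I. f i) \<le> (\<integral>\<^sup>+i. emeasure M (f i) \<partial>count_space I)"
proof -
  have "emeasure M (\<Union>i\<in>I. f i) = (\<integral>\<^sup>+x. indicator (\<Union>i\<in>I. f i) x \<partial>M)"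
    using assms by (subst nn_integral_indicator) (auto intro: sets.countable_UN')
  also have "\<dots> \<le> (\<integral>\<^sup>+x. \<integral>\<^sup>+i. indicator (f i) x \<partial>count_space I \<partial>M)"
  proof (rule nn_integral_mono)
    fix x
    show "indicator (\<Union>i\<in>I. f i) x \<le> (\<integral>\<^sup>+i. indicator (f i) x \<partial>count_space I)"
    proof (cases "x \<in> (\<Union>i\<in>I. f i)")
      case True
      then obtain i where "i \<in> I" "x \<in> f i" by auto
      then show ?thesis
        using True nn_integral_ge_point[of i I "\<lambda>i. indicator (f i) x"] by simp
    qed simp
  qed
  also have "\<dots> = (\<integral>\<^sup>+i. \<integral>\<^sup>+x. indicator (f i) x \<partial>M \<partial>count_space I)"
    using assms by (intro nn_integral_count_space_nn_integral) auto
  also have "\<dots> = (\<integral>\<^sup>+i. emeasure M (f i) \<partial>count_space I)"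
    by (intro nn_integral_cong) (auto simp: nn_integral_indicator assms)
  finally show ?thesis .
qed

text \<open>
  A direct Fubini argument: the library's determinant formula for linear images is only stated for
  well-ordered index types.
\<close>

lemma emeasure_linear_vimage_exchange:
  fixes g h :: "'a::euclidean_space \<Rightarrow> 'a"
  assumes h: "linear h" and hg: "\<And>x. h (g x) = x"
    and [measurable]: "A \<in> sets borel" "B \<in> sets borel"
  shows "emeasure lborel (h -` A) * emeasure lborel B = emeasure lborel A * emeasure lborel (h -` B)"
proof -
  have [measurable]: "h \<in> borel_measurable borel"
    using h by (intro borel_measurable_continuous_onI linear_continuous_on) (simp add: linear_conv_bounded_linear)
  have hadd: "h (x + y) = h x + h y" for x y using h by (rule linear_add)
  have vim: "h -` C \<in> sets borel" if "C \<in> sets borel" for C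
    using measurable_sets[of h borel borel C] that by simp
  have I: "(\<integral>\<^sup>+x. indicator C (h x) \<partial>lborel) = emeasure lborel (h -` C)"
    if [measurable]: "C \<in> sets borel" for C :: "'a set"
    using vim[OF that] by (subst nn_integral_indicator[symmetric]) (auto simp: indicator_def cong: nn_integral_cong)
  have refl: "(\<integral>\<^sup>+y. indicator C (a - y) \<partial>lborel) = emeasure lborel C"
    if [measurable]: "C \<in> sets borel" for C :: "'a set" and a
  proof -
    have "distr lborel borel (\<lambda>x. a - x) = (lborel :: 'a measure)"
      using lborel_affine[of "-1" a] by (simp add: density_1)
    then have "(\<integral>\<^sup>+y. indicator C y \<partial>lborel) = (\<integral>\<^sup>+y. indicator C y \<partial>distr lborel borel (\<lambda>x. a - x))"
      by simp
    also have "\<dots> = (\<integral>\<^sup>+y. indicator C (a - y) \<partial>lborel)"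
      by (subst nn_integral_distr) auto
    finally show ?thesis by simp
  qed
  have trans: "(\<integral>\<^sup>+x. f (x + a) \<partial>lborel) = (\<integral>\<^sup>+x. f x \<partial>lborel)"
    if [measurable]: "f \<in> borel_measurable borel" for f :: "'a \<Rightarrow> ennreal" and a
  proof -
    have "(\<integral>\<^sup>+x. f (x + a) \<partial>lborel) = (\<integral>\<^sup>+y. f y \<partial>distr lborel borel ((+) a))"
      by (subst nn_integral_distr) (auto simp: add.commute)
    then show ?thesis by (simp add: lborel_distr_plus)
  qed
  have "emeasure lborel (h -` A) * emeasure lborel B
      = (\<integral>\<^sup>+x. indicator A (h x) * emeasure lborel B \<partial>lborel)"
    by (simp add: nn_integral_multc I)
  also have "\<dots> = (\<integral>\<^sup>+x. indicator A (h x) * (\<integral>\<^sup>+y. indicator B (h x - y) \<partial>lborel) \<partial>lborel)"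
    by (simp add: refl)
  also have "\<dots> = (\<integral>\<^sup>+x. \<integral>\<^sup>+y. indicator A (h x) * indicator B (h x - y) \<partial>lborel \<partial>lborel)"
    by (simp add: nn_integral_cmult)
  also have "\<dots> = (\<integral>\<^sup>+y. \<integral>\<^sup>+x. indicator A (h x) * indicator B (h x - y) \<partial>lborel \<partial>lborel)"
    by (rule lborel_pair.Fubini') measurable
  \<comment> \<open>The shift of \<open>x\<close> by \<open>g y\<close> turns \<open>h x\<close>
    into \<open>h x + y\<close>, so the variable \<open>y\<close> moves from the indicator of
    \<open>B\<close> to that of \<open>A\<close>. Integrating over \<open>y\<close> first then
    yields the measure of \<open>A\<close> instead of that of \<open>B\<close>.\<close>
  also have "\<dots> = (\<integral>\<^sup>+y. \<integral>\<^sup>+x. indicator A (h (x + g y)) * indicator B (h (x + g y) - y) \<partial>lborel \<partial>lborel)"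
    by (subst trans) auto
  also have "\<dots> = (\<integral>\<^sup>+y. \<integral>\<^sup>+x. indicator A (h x + y) * indicator B (h x) \<partial>lborel \<partial>lborel)"
    by (simp add: hadd hg)
  also have "\<dots> = (\<integral>\<^sup>+x. \<integral>\<^sup>+y. indicator A (h x + y) * indicator B (h x) \<partial>lborel \<partial>lborel)"
    by (rule lborel_pair.Fubini') measurable
  also have "\<dots> = (\<integral>\<^sup>+x. (\<integral>\<^sup>+y. indicator A (y + h x) \<partial>lborel) * indicator B (h x) \<partial>lborel)"
    by (simp add: nn_integral_multc add.commute)
  also have "\<dots> = (\<integral>\<^sup>+x. emeasure lborel A * indicator B (h x) \<partial>lborel)"
    by (subst trans) auto
  also have "\<dots> = emeasure lborel A * emeasure lborel (h -` B)"
    by (simp add: nn_integral_cmult I)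
  finally show ?thesis .
qed

text \<open>The factor \<open>c\<close> is the volume of the image of the unit cube, by the exchange
  identity with a set \<open>B\<close> of volume 1. It is finite because that image is compact, and
  nonzero because otherwise the whole space, being the image of \<open>g\<close>, would be a null
  set.\<close>

lemma linear_image_scales_lborel:
  fixes g :: "'a::euclidean_space \<Rightarrow> 'a"
  assumes "linear g" "inj g"
  obtains c :: real where "c > 0" "\<And>A. A \<in> sets borel \<Longrightarrow> g ` A \<in> sets borel"
    "\<And>A. A \<in> sets borel \<Longrightarrow> emeasure lborel (g ` A) = ennreal c * emeasure lborel A"
proof -
  obtain h where h: "linear h" and hg: "\<And>x. h (g x) = x" and gh: "\<And>x. g (h x) = x"
    using linear_injective_isomorphism[OF assms] by auto
  have vim: "g ` A = h -` A" for A
    using hg gh by (auto simp: image_iff) (metis gh)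
  have hm: "h \<in> borel_measurable borel"
    using h by (intro borel_measurable_continuous_onI linear_continuous_on) (simp add: linear_conv_bounded_linear)
  have meas: "g ` A \<in> sets borel" if "A \<in> sets borel" for A
    using measurable_sets[OF hm that] by (simp add: vim)
  define B where "B = cbox (0::'a) One"
  have B: "B \<in> sets borel" "emeasure lborel B = 1"
    by (auto simp: B_def emeasure_lborel_cbox)
  have scale: "emeasure lborel (g ` A) = emeasure lborel (g ` B) * emeasure lborel A" if "A \<in> sets borel" for A
    using emeasure_linear_vimage_exchange[OF h hg that B(1)] B(2) by (simp add: vim mult.commute)
  have "compact (g ` B)"
    unfolding B_def by (intro compact_continuous_image linear_continuous_on) 
      (use assms in \<open>auto simp: linear_conv_bounded_linear\<close>)
  then have "emeasure lborel (g ` B) < \<infinity>"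
    by (intro emeasure_bounded_finite compact_imp_bounded)
  then obtain c where c: "c \<ge> 0" "emeasure lborel (g ` B) = ennreal c"
    by (cases "emeasure lborel (g ` B)") auto
  have "c \<noteq> 0"
  proof
    assume "c = 0"
    then have "emeasure lborel (g ` UNIV) = 0"
      using scale[of UNIV] c by simp
    moreover have "g ` UNIV = UNIV" by (simp add: vim)
    ultimately show False by simp
  qed
  with c scale meas show thesis by (intro that[of c]) auto
qed

section \<open>Standard simplex and its difference body\<close>

lemma Basis_cart_eq: "(Basis :: (real ^ 'n) set) = range (\<lambda>i. axis i 1)"
  by (auto simp: Basis_vec_def)

text \<open>The larger of \<open>pos_sum x\<close> and \<open>pos_sum (- x)\<close> is the gauge of
  the difference body of the standard simplex.\<close>

definition pos_sum :: "real ^ 'n \<Rightarrow> real"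
  where "pos_sum x = (\<Sum>i\<in>UNIV. max 0 (x $ i))"

lemma pos_sum_add_le: "pos_sum (x + y) \<le> pos_sum x + pos_sum y"
  unfolding pos_sum_def sum.distrib[symmetric] by (intro sum_mono) auto

definition std_simplex_cart :: "(real ^ 'n) set"
  where "std_simplex_cart = {x. (\<forall>i. 0 \<le> x $ i) \<and> (\<Sum>i\<in>UNIV. x $ i) \<le> 1}"

lemma std_simplex_cart_eq: "(std_simplex_cart :: (real ^ 'n) set) = convex hull (insert 0 Basis)"
proof -
  have "(\<Sum>i\<in>Basis. x \<bullet> i) = (\<Sum>i\<in>UNIV. x $ i)" for x :: "real ^ 'n"
    unfolding Basis_cart_eq by (subst sum.reindex) (auto simp: inj_on_def axis_eq_axis inner_axis)
  then show ?thesis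
    unfolding std_simplex std_simplex_cart_def by (auto simp: Basis_cart_eq inner_axis)
qed

lemma compact_std_simplex_cart: "compact (std_simplex_cart :: (real ^ 'n) set)"
  unfolding std_simplex_cart_eq by (intro finite_imp_compact_convex_hull) auto

lemma emeasure_std_simplex_cart:
  "emeasure lborel (std_simplex_cart :: (real ^ 'n) set) = ennreal (1 / fact CARD('n))"
  by (simp add: std_simplex_cart_eq emeasure_std_simplex)

text \<open>The corner of the small copy is the positive part of \<open>x\<close>. Subtracting
  \<open>x\<close> from it leaves the negative part, so both corners are nonnegative with coordinate
  sum at most \<open>1 - r\<close>, which leaves room for a simplex of size
  \<open>r\<close>.\<close>

lemma std_simplex_cart_translate_inter:
  fixes x :: "real ^ 'n"
  assumes r: "pos_sum x \<le> 1 - r" "pos_sum (- x) \<le> 1 - r" and "0 \<le> r"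
    and z: "z \<in> std_simplex_cart"
  defines "y \<equiv> (\<chi> i. max 0 (x $ i)) + r *\<^sub>R z"
  shows "y \<in> std_simplex_cart" "y - x \<in> std_simplex_cart"
proof -
  have rz: "0 \<le> r * z $ i" for i using z \<open>0 \<le> r\<close> by (simp add: std_simplex_cart_def)
  have "r * (\<Sum>i\<in>UNIV. z $ i) \<le> r * 1"
    using z \<open>0 \<le> r\<close> by (intro mult_left_mono) (auto simp: std_simplex_cart_def)
  then have rs: "(\<Sum>i\<in>UNIV. r * z $ i) \<le> r" by (simp add: sum_distrib_left)
  show "y \<in> std_simplex_cart"
    using rz rs r(1) by (auto simp: std_simplex_cart_def y_def pos_sum_def sum.distrib)
  have "(y - x) $ i = max 0 (- x $ i) + r * z $ i" for i by (simp add: y_def)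
  then show "y - x \<in> std_simplex_cart"
    using rz rs r(2) by (auto simp: std_simplex_cart_def pos_sum_def sum.distrib)
qed

section \<open>Volume of the difference body\<close>

text \<open>This is Pascal's rule. The two sums on the right are the integrals of
  \<open>F n (s - y) t\<close> over \<open>y\<close> in [0, s] and of \<open>F n s (t + y)\<close>
  over \<open>y\<close> in [-t, 0], which arise when one coordinate is integrated out.\<close>

lemma signed_simplex_volume_Suc:
  fixes s t :: real
  defines "F \<equiv> (\<lambda>n s t. \<Sum>k\<le>n. real (n choose k) / (fact k * fact (n - k)) * s ^ k * t ^ (n - k))"
  shows "F (Suc n) s t =
    (\<Sum>k\<le>n. real (n choose k) / (fact k * fact (n - k)) * (s ^ Suc k / Suc k) * t ^ (n - k)) +
    (\<Sum>k\<le>n. real (n choose k) / (fact k * fact (n - k)) * s ^ k * (t ^ Suc (n - k) / Suc (n - k)))"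
proof -
  define c where "c k = s ^ k * t ^ (Suc n - k) / (fact k * fact (Suc n - k))" for k
  have "F (Suc n) s t = (\<Sum>k\<le>Suc n. real (Suc n choose k) * c k)"
    by (simp add: F_def c_def del: sum.atMost_Suc binomial_Suc_Suc)
      (simp add: mult.assoc del: sum.atMost_Suc)
  also have "\<dots> = c 0 + (\<Sum>k\<le>n. real (Suc n choose Suc k) * c (Suc k))"
    by (subst sum.atMost_Suc_shift) simp
  also have "\<dots> = (\<Sum>k\<le>n. real (n choose k) * c (Suc k)) + (c 0 + (\<Sum>k\<le>n. real (n choose Suc k) * c (Suc k)))"
    by (simp add: sum.distrib[symmetric] algebra_simps)
  also have "c 0 + (\<Sum>k\<le>n. real (n choose Suc k) * c (Suc k)) = (\<Sum>k\<le>Suc n. real (n choose k) * c k)"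
    by (subst sum.atMost_Suc_shift) simp
  also have "\<dots> = (\<Sum>k\<le>n. real (n choose k) * c k)" by simp
  also have "(\<Sum>k\<le>n. real (n choose k) * c (Suc k)) =
    (\<Sum>k\<le>n. real (n choose k) / (fact k * fact (n - k)) * (s ^ Suc k / Suc k) * t ^ (n - k))"
    by (intro sum.cong) (simp_all add: c_def mult_ac)
  also have "(\<Sum>k\<le>n. real (n choose k) * c k) =
    (\<Sum>k\<le>n. real (n choose k) / (fact k * fact (n - k)) * s ^ k * (t ^ Suc (n - k) / Suc (n - k)))"
    by (intro sum.cong) (simp_all add: c_def mult_ac Suc_diff_le)
  finally show ?thesis .
qed

text \<open>The k-th term of \<open>F\<close> counts the choices of k nonnegative coordinates; each
  gives a product of two simplices with volumes \<open>s ^ k / fact k\<close> and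
  \<open>t ^ (n - k) / fact (n - k)\<close>. The proof integrates out one coordinate at a time,
  which is why \<open>s\<close> and \<open>t\<close> vary independently.\<close>

lemma emeasure_signed_simplex_aux:
  fixes s t :: real
  defines "S \<equiv> (\<lambda>A s t. {x::'a \<Rightarrow> real. (\<Sum>i\<in>A. max 0 (x i)) \<le> s \<and> (\<Sum>i\<in>A. max 0 (- x i)) \<le> t})"
  defines "F \<equiv> (\<lambda>n s t. \<Sum>k\<le>n. real (n choose k) / (fact k * fact (n - k)) * s ^ k * t ^ (n - k))"
  assumes "finite (A :: 'a set)" "s \<ge> 0" "t \<ge> 0"
  shows "emeasure (Pi\<^sub>M A (\<lambda>_. lborel)) (S A s t \<inter> space (Pi\<^sub>M A (\<lambda>_. lborel))) = ennreal (F (card A) s t)"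
  using assms(3-5)
proof (induction arbitrary: s t rule: finite_induct)
  case (empty s t)
  then show ?case by (simp add: PiM_empty S_def F_def)
next
  case (insert b A s t)
  define n where "n = card A"
  let ?M = "\<lambda>A. (Pi\<^sub>M A (\<lambda>_. lborel :: real measure))"
  have meas [measurable]: "S A s t \<inter> space (?M A) \<in> sets (?M A)" if "finite A" for A s t
  proof -
    have "S A s t \<inter> space (?M A) = {x \<in> space (?M A). (\<Sum>i\<in>A. max 0 (x i)) \<le> s \<and> (\<Sum>i\<in>A. max 0 (- x i)) \<le> t}"
      by (auto simp: S_def)
    also have "\<dots> \<in> sets (?M A)" using that by measurable
    finally show ?thesis .
  qed
  \<comment> \<open>A nonnegative new coordinate uses up part of the budget \<open>s\<close>, a
    negative one part of the budget \<open>t\<close>.\<close>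
  have step: "x(b := y) \<in> S (insert b A) s t \<longleftrightarrow> (if y \<ge> 0 then x \<in> S A (s - y) t else x \<in> S A s (t + y))" for x y
  proof -
    have "(\<Sum>i\<in>A. max 0 ((x(b := y)) i)) = (\<Sum>i\<in>A. max 0 (x i))"
      "(\<Sum>i\<in>A. max 0 (- (x(b := y)) i)) = (\<Sum>i\<in>A. max 0 (- x i))"
      using insert.hyps by (auto intro!: sum.cong)
    then show ?thesis using insert.hyps by (auto simp: S_def)
  qed
  have neg: "S A s t = {}" if "s < 0 \<or> t < 0" for s t
  proof -
    have "0 \<le> (\<Sum>i\<in>A. max 0 (x i))" "0 \<le> (\<Sum>i\<in>A. max 0 (- x i))" for x :: "'a \<Rightarrow> real"
      by (auto intro: sum_nonneg)
    with that show ?thesis unfolding S_def by (smt (verit) Collect_empty_eq)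
  qed
  interpret product_sigma_finite "\<lambda>_. lborel" by standard
  have "emeasure (?M (insert b A)) (S (insert b A) s t \<inter> space (?M (insert b A))) =
        nn_integral (?M (insert b A)) (indicator (S (insert b A) s t \<inter> space (?M (insert b A))))"
    using insert.hyps by (subst nn_integral_indicator) auto
  also have "\<dots> = (\<integral>\<^sup>+ y. \<integral>\<^sup>+ x. indicator (S (insert b A) s t \<inter> space (?M (insert b A)))
                    (x(b := y)) \<partial>?M A \<partial>lborel)"
    using insert.hyps by (intro product_nn_integral_insert_rev) auto
  also have "\<dots> = (\<integral>\<^sup>+ y. \<integral>\<^sup>+ x. indicator (S A (s - max 0 y) (t - max 0 (- y)) \<inter> space (?M A)) x \<partial>?M A \<partial>lborel)"
    using insert.hyps step
    by (intro nn_integral_cong) (auto simp: fun_eq_iff indicator_def space_PiM PiE_def extensional_def max_def)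
  also have "\<dots> = (\<integral>\<^sup>+ y. emeasure (?M A) (S A (s - max 0 y) (t - max 0 (- y)) \<inter> space (?M A)) \<partial>lborel)"
    using insert.hyps by (subst nn_integral_indicator) auto
  also have "\<dots> = (\<integral>\<^sup>+ y. ennreal (F n (s - y) t) * indicator {0..s} y + ennreal (F n s (t + y)) * indicator {-t..0} y \<partial>lborel)"
  \<comment> \<open>The point 0 lies in both closed intervals and would be counted twice, so the
    integrands are compared only almost everywhere.\<close>
  proof (rule nn_integral_cong_AE, rule AE_mp[OF AE_lborel_singleton[of 0]], rule AE_I2, rule impI)
    fix y :: real assume "y \<noteq> 0"
    then show "emeasure (?M A) (S A (s - max 0 y) (t - max 0 (- y)) \<inter> space (?M A)) =
      ennreal (F n (s - y) t) * indicator {0..s} y + ennreal (F n s (t + y)) * indicator {-t..0} y"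
      using insert.IH[of "s - max 0 y" "t - max 0 (- y)"] neg[of "s - max 0 y" "t - max 0 (- y)"] insert.prems
      by (cases "y > 0"; cases "y \<le> s"; cases "- t \<le> y") (auto simp: n_def)
  qed
  also have "\<dots> = (\<integral>\<^sup>+ y. ennreal (F n (s - y) t) * indicator {0..s} y \<partial>lborel)
      + (\<integral>\<^sup>+ y. ennreal (F n s (t + y)) * indicator {-t..0} y \<partial>lborel)"
    unfolding F_def by (subst nn_integral_add) auto
  also have "(\<integral>\<^sup>+ y. ennreal (F n (s - y) t) * indicator {0..s} y \<partial>lborel) =
      ennreal ((- (\<Sum>k\<le>n. real (n choose k) / (fact k * fact (n - k)) * ((s - s) ^ Suc k / Suc k) * t ^ (n - k))) -
       (- (\<Sum>k\<le>n. real (n choose k) / (fact k * fact (n - k)) * ((s - 0) ^ Suc k / Suc k) * t ^ (n - k))))"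
  proof (rule nn_integral_FTC_Icc)
    fix y assume "y \<in> {0..s}"
    show "((\<lambda>y. - (\<Sum>k\<le>n. real (n choose k) / (fact k * fact (n - k)) * ((s - y) ^ Suc k / Suc k) * t ^ (n - k)))
        has_real_derivative F n (s - y) t) (at y)"
      unfolding F_def sum_negf[symmetric]
      by (intro derivative_eq_intros refl sum.cong) (auto intro!: derivative_eq_intros simp del: power_Suc)
    show "F n (s - y) t \<ge> 0" unfolding F_def using \<open>y \<in> {0..s}\<close> insert.prems by (intro sum_nonneg) auto
  qed (use insert.prems in \<open>auto simp: F_def\<close>)
  also have "(\<integral>\<^sup>+ y. ennreal (F n s (t + y)) * indicator {-t..0} y \<partial>lborel) =
      ennreal ((\<Sum>k\<le>n. real (n choose k) / (fact k * fact (n - k)) * s ^ k * ((t + 0) ^ Suc (n - k) / Suc (n - k))) -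
       (\<Sum>k\<le>n. real (n choose k) / (fact k * fact (n - k)) * s ^ k * ((t + (- t)) ^ Suc (n - k) / Suc (n - k))))"
  proof (rule nn_integral_FTC_Icc)
    fix y assume "y \<in> {-t..0}"
    show "((\<lambda>y. \<Sum>k\<le>n. real (n choose k) / (fact k * fact (n - k)) * s ^ k * ((t + y) ^ Suc (n - k) / Suc (n - k)))
        has_real_derivative F n s (t + y)) (at y)"
      unfolding F_def
      by (intro derivative_eq_intros refl sum.cong) (auto intro!: derivative_eq_intros simp del: power_Suc)
    show "F n s (t + y) \<ge> 0" unfolding F_def using \<open>y \<in> {-t..0}\<close> insert.prems by (intro sum_nonneg) auto
  qed (use insert.prems in \<open>auto simp: F_def\<close>)
  finally have "emeasure (?M (insert b A)) (S (insert b A) s t \<inter> space (?M (insert b A))) =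
    ennreal (\<Sum>k\<le>n. real (n choose k) / (fact k * fact (n - k)) * (s ^ Suc k / Suc k) * t ^ (n - k)) +
    ennreal (\<Sum>k\<le>n. real (n choose k) / (fact k * fact (n - k)) * s ^ k * (t ^ Suc (n - k) / Suc (n - k)))"
    by simp
  also have "\<dots> = ennreal (F (Suc n) s t)"
    unfolding F_def signed_simplex_volume_Suc using insert.prems
    by (intro ennreal_plus[symmetric] sum_nonneg) auto
  finally show ?case using insert.hyps by (simp add: n_def)
qed

text \<open>This is \<open>r(\<Delta> - \<Delta>)\<close> for the standard simplex \<open>\<Delta>\<close>.\<close>

definition diff_body :: "real \<Rightarrow> (real ^ 'n) set"
  where "diff_body r = {x. pos_sum x \<le> r \<and> pos_sum (- x) \<le> r}"

lemma closed_diff_body: "closed (diff_body r)"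
  unfolding diff_body_def pos_sum_def
  by (intro closed_Collect_conj closed_Collect_le continuous_intros)

text \<open>For equal budgets the k-th term is \<open>r ^ n / fact n\<close> times the square of
  \<open>n choose k\<close>, and these squares add up to the central binomial coefficient.\<close>

lemma emeasure_diff_body:
  assumes "r \<ge> 0"
  shows "emeasure lborel (diff_body r :: (real ^ 'n) set) =
    ennreal (r ^ CARD('n) * real (2 * CARD('n) choose CARD('n)) / fact CARD('n))"
proof -
  have sumB: "(\<Sum>i\<in>Basis. f (x \<bullet> i)) = (\<Sum>i\<in>UNIV. f (x $ i))" for x :: "real ^ 'n" and f :: "real \<Rightarrow> real"
    unfolding Basis_cart_eq by (subst sum.reindex) (auto simp: inj_on_def axis_eq_axis inner_axis)
  have meas: "diff_body r \<in> sets (borel :: (real ^ 'n) measure)"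
    by (simp add: closed_diff_body borel_closed)
  define n where "n = CARD('n)"
  have "emeasure lborel (diff_body r :: (real ^ 'n) set) =
      emeasure (distr (Pi\<^sub>M Basis (\<lambda>b. lborel)) borel (\<lambda>f. \<Sum>b\<in>Basis. f b *\<^sub>R b)) (diff_body r :: (real ^ 'n) set)"
    by (subst lborel_eq) simp
  also have "\<dots> = emeasure (Pi\<^sub>M Basis (\<lambda>b. lborel))
      ({x. (\<Sum>i\<in>Basis. max 0 (x i)) \<le> r \<and> (\<Sum>i\<in>Basis. max 0 (- x i)) \<le> r} \<inter>
        space (Pi\<^sub>M (Basis :: (real ^ 'n) set) (\<lambda>b. lborel)))"
    using meas
    by (subst emeasure_distr)
       (auto simp: diff_body_def pos_sum_def sumB[of "max 0", symmetric] sumB[of "\<lambda>x. max 0 (- x)", symmetric]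
         inner_sum_left_Basis intro!: arg_cong2[where f = emeasure])
  also have "\<dots> = ennreal (\<Sum>k\<le>n. real (n choose k) / (fact k * fact (n - k)) * r ^ k * r ^ (n - k))"
    using assms by (subst emeasure_signed_simplex_aux) (auto simp: n_def)
  also have "(\<Sum>k\<le>n. real (n choose k) / (fact k * fact (n - k)) * r ^ k * r ^ (n - k)) =
      (\<Sum>k\<le>n. r ^ n / fact n * real ((n choose k)\<^sup>2))"
    by (intro sum.cong) (auto simp: binomial_fact power2_eq_square field_simps simp flip: power_add)
  also have "\<dots> = r ^ n * real (2 * n choose n) / fact n"
    unfolding sum_distrib_left[symmetric] of_nat_sum[symmetric] choose_square_sum by simp
  finally show ?thesis by (simp add: n_def)
qed

text \<open>The ratio of consecutive central binomial coefficients is 2(2n + 1)/(n + 1), which is at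
  least 16/7, so the left side does not decrease. At n = 3 it equals 20 * 343/4096.\<close>

lemma central_binomial_bound:
  assumes "n \<ge> 3"
  shows "(7 / 16) ^ n * real (2 * n choose n) > 1"
  using assms
proof (induction n rule: dec_induct)
  case base
  show ?case by (simp add: eval_nat_numeral)
next
  case (step n)
  have "real (2 * Suc n choose Suc n) * real (n + 1) = real (2 * n choose n) * (2 * real (2 * n + 1))"
  proof -
    define a b c where "a = (2 * Suc n choose Suc n)" and "b = (Suc (2 * n) choose n)" and "c = (2 * n choose n)"
    have "(n + 1) * a = (n + 1) * (2 * b)"
      using Suc_times_binomial[of n "Suc (2 * n)"] by (simp add: a_def b_def del: binomial_Suc_Suc)
    then have "a = 2 * b" by (metis add_is_0 mult_left_cancel one_neq_zero)
    moreover have "(Suc (2 * n) choose Suc n) = b"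
      using binomial_symmetric[of n "Suc (2 * n)"] by (simp add: b_def del: binomial_Suc_Suc)
    then have "(n + 1) * b = (2 * n + 1) * c"
      using Suc_times_binomial[of n "2 * n"] by (simp add: c_def del: binomial_Suc_Suc)
    ultimately have "a * (n + 1) = c * (2 * (2 * n + 1))"
      by (simp add: mult.commute mult.left_commute)
    then have "real (a * (n + 1)) = real (c * (2 * (2 * n + 1)))" by (rule arg_cong)
    then show ?thesis by (simp only: a_def c_def of_nat_mult of_nat_numeral)
  qed
  then have "real (2 * Suc n choose Suc n) = real (2 * n choose n) * (2 * real (2 * n + 1) / real (n + 1))"
    by (simp add: field_simps)
  moreover have "2 * real (2 * n + 1) / real (n + 1) \<ge> 16 / 7"
    using step by (simp add: field_simps)
  ultimately have "real (2 * Suc n choose Suc n) \<ge> real (2 * n choose n) * (16 / 7)"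
    by (metis mult_left_mono of_nat_0_le_iff)
  then have "(7 / 16) ^ Suc n * real (2 * Suc n choose Suc n) \<ge> (7 / 16) ^ Suc n * (real (2 * n choose n) * (16 / 7))"
    by (intro mult_left_mono) auto
  moreover have "(7 / 16) ^ Suc n * (real (2 * n choose n) * (16 / 7)) = (7 / 16) ^ n * real (2 * n choose n)"
    by (simp del: binomial_Suc_Suc)
  ultimately show ?case using step.IH by linarith
qed

section \<open>Packings and coverings modulo a lattice\<close>

text \<open>Injectivity modulo \<open>L\<close>: for a subgroup \<open>L\<close>, distinct
  translates of \<open>X\<close> are disjoint. Arbitrary sets are allowed, since half-open cells and
  nonconvex differences of simplices occur below.\<close>

definition packs :: "'a::ab_group_add set \<Rightarrow> 'a set \<Rightarrow> bool"
  where "packs X L \<longleftrightarrow> (\<forall>x\<in>X. \<forall>y\<in>X. x - y \<in> L \<longrightarrow> x = y)"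

definition covers :: "'a::ab_group_add set \<Rightarrow> 'a set \<Rightarrow> bool"
  where "covers Y L \<longleftrightarrow> (\<forall>x. \<exists>u\<in>L. x - u \<in> Y)"

definition add_subgroup :: "'a::ab_group_add set \<Rightarrow> bool"
  where "add_subgroup L \<longleftrightarrow> 0 \<in> L \<and> (\<forall>u\<in>L. \<forall>v\<in>L. u - v \<in> L)"

lemma add_subgroup_uminus: "add_subgroup L \<Longrightarrow> u \<in> L \<Longrightarrow> - u \<in> L"
  unfolding add_subgroup_def by (metis diff_0)

lemma add_subgroup_add: "add_subgroup L \<Longrightarrow> u \<in> L \<Longrightarrow> v \<in> L \<Longrightarrow> u + v \<in> L"
  using add_subgroup_uminus[of L v] unfolding add_subgroup_def by (metis diff_minus_eq_add)

lemma add_subgroup_multiple: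
  fixes u :: "'a::real_vector"
  assumes "add_subgroup L" "u \<in> L"
  shows "real k *\<^sub>R u \<in> L"
proof (induction k)
  case (Suc k)
  have "real (Suc k) *\<^sub>R u = real k *\<^sub>R u + u" by (simp add: algebra_simps)
  then show ?case using Suc add_subgroup_add[OF assms(1)] assms(2) by simp
qed (use assms in \<open>simp add: add_subgroup_def\<close>)

text \<open>Cut \<open>X\<close> along the translates of \<open>Y\<close> and move each piece back
  into \<open>Y\<close>. The moved pieces do not overlap because \<open>X\<close> is injective
  modulo \<open>L\<close>.\<close>

lemma emeasure_packs_le_covers:
  fixes X Y :: "'a::euclidean_space set"
  assumes L: "countable L" "add_subgroup L" and "packs X L" "covers Y L"
    and meas: "X \<in> sets borel" "Y \<in> sets borel"
  shows "emeasure lborel X \<le> emeasure lborel Y"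
proof -
  let ?t = "\<lambda>u A. (\<lambda>x::'a. x + u) ` A"
  have mt: "?t u A \<in> sets borel" if "A \<in> sets borel" for u A
    using that by (rule emeasure_lborel_translate)
  have X: "X = (\<Union>u\<in>L. X \<inter> ?t u Y)"
    using \<open>covers Y L\<close> by (force simp: covers_def image_iff)
  have "emeasure lborel X = emeasure lborel (\<Union>u\<in>L. X \<inter> ?t u Y)"
    using X by simp
  also have "\<dots> \<le> (\<integral>\<^sup>+u. emeasure lborel (X \<inter> ?t u Y) \<partial>count_space L)"
    using meas mt L by (intro emeasure_UN_le_nn_integral) auto
  also have "\<dots> = (\<integral>\<^sup>+u. emeasure lborel (?t (- u) X \<inter> Y) \<partial>count_space L)"
  proof (rule nn_integral_cong)
    fix u
    have "?t (- u) (X \<inter> ?t u Y) = ?t (- u) X \<inter> Y"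
      by (force simp: image_iff)
    then show "emeasure lborel (X \<inter> ?t u Y) = emeasure lborel (?t (- u) X \<inter> Y)"
      using emeasure_lborel_translate(2)[of "X \<inter> ?t u Y" "- u"] meas mt by simp
  qed
  also have "\<dots> = emeasure lborel (\<Union>u\<in>L. ?t (- u) X \<inter> Y)"
  proof (rule emeasure_UN_countable[symmetric])
    show "disjoint_family_on (\<lambda>u. ?t (- u) X \<inter> Y) L"
      unfolding disjoint_family_on_def
    proof (intro ballI impI)
      fix u v assume uv: "u \<in> L" "v \<in> L" "u \<noteq> v"
      have False if "x + - u = y + - v" "x \<in> X" "y \<in> X" for x y
      proof -
        have "x - y = u - v" using that(1) by (simp add: algebra_simps)
        moreover have "u - v \<in> L" using uv L by (simp add: add_subgroup_def)
        ultimately have "x = y" using that \<open>packs X L\<close> by (simp add: packs_def)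
        with \<open>x - y = u - v\<close> \<open>u \<noteq> v\<close> show False by simp
      qed
      then show "(?t (- u) X \<inter> Y) \<inter> (?t (- v) X \<inter> Y) = {}" by auto
    qed
    show "?t (- u) X \<inter> Y \<in> sets lborel" for u
      using mt[OF meas(1), of "- u"] meas by simp
  qed (use L in auto)
  also have "\<dots> \<le> emeasure lborel Y"
    using meas by (intro emeasure_mono) auto
  finally show ?thesis .
qed

text \<open>Starting from a representative of \<open>x\<close> in \<open>T\<close>, subtract
  \<open>u\<close> repeatedly. Since \<open>T\<close> is bounded, the sequence leaves it; a point of
  \<open>T\<close> whose successor is outside \<open>T\<close> is not in
  \<open>T + u\<close>.\<close>

lemma covers_minus_translate:
  fixes T :: "'a::real_normed_vector set"
  assumes "add_subgroup L" "covers T L" "bounded T" "u \<in> L" "u \<noteq> 0"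
  shows "covers (T - (\<lambda>x. x + u) ` T) L"
  unfolding covers_def
proof
  fix x
  obtain w where w: "w \<in> L" "x - w \<in> T" using assms by (auto simp: covers_def)
  define P where "P k \<longleftrightarrow> x - w - real k *\<^sub>R u \<in> T" for k
  obtain R where R: "\<And>y. y \<in> T \<Longrightarrow> norm y \<le> R" using \<open>bounded T\<close> by (auto simp: bounded_iff)
  obtain m :: nat where m: "(R + norm (x - w)) / norm u < real m" using reals_Archimedean2 by blast
  have "\<not> P m"
  proof
    assume "P m"
    then have "norm (x - w - real m *\<^sub>R u) \<le> R" by (simp add: P_def R)
    moreover have "norm (real m *\<^sub>R u) \<le> norm (x - w) + norm (x - w - real m *\<^sub>R u)"
      by (smt (verit) norm_triangle_sub norm_minus_commute)
    ultimately have "real m * norm u \<le> R + norm (x - w)" by simp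
    with m \<open>u \<noteq> 0\<close> show False by (simp add: field_simps)
  qed
  moreover have "P 0" using w by (simp add: P_def)
  ultimately obtain k where k: "P k" "\<not> P (Suc k)"
    by (metis nat_induct)
  have "w + real k *\<^sub>R u \<in> L"
    using assms w by (intro add_subgroup_add add_subgroup_multiple)
  moreover have "x - (w + real k *\<^sub>R u) \<in> T - (\<lambda>x. x + u) ` T"
    using k by (auto simp: P_def image_iff algebra_simps)
  ultimately show "\<exists>v\<in>L. x - v \<in> T - (\<lambda>x. x + u) ` T" by blast
qed

lemma packs_image:
  assumes "linear g" "inj g" "packs X L"
  shows "packs (g ` X) (g ` L)"
  using assms unfolding packs_def by (auto simp: linear_diff[symmetric] dest: injD)

lemma add_subgroup_image: "linear g \<Longrightarrow> add_subgroup L \<Longrightarrow> add_subgroup (g ` L)"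
  unfolding add_subgroup_def using linear_0[of g] by (force simp: linear_diff[symmetric] image_iff)

section \<open>Lattice coordinates\<close>

text \<open>The linear map taking the standard basis to the family \<open>b\<close>. It carries
  \<open>int_cart\<close>, \<open>unit_cell\<close> and \<open>std_simplex_cart\<close> to a general
  lattice, its cell and a general simplex with a vertex at 0.\<close>

definition lincomb :: "('n \<Rightarrow> real ^ 'n) \<Rightarrow> real ^ 'n \<Rightarrow> real ^ 'n"
  where "lincomb b x = (\<Sum>i\<in>UNIV. x $ i *\<^sub>R b i)"

lemma linear_lincomb: "linear (lincomb b)"
  by (intro linearI) (simp_all add: lincomb_def algebra_simps sum.distrib scaleR_sum_right)

lemma lincomb_axis: "lincomb b (axis i 1) = b i"
  by (simp add: lincomb_def axis_def if_distrib[of "\<lambda>c. c *\<^sub>R _"] cong: if_cong)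

lemma inj_lincomb:
  assumes "inj b" "independent (range b)"
  shows "inj (lincomb b)"
proof -
  have "x = 0" if "lincomb b x = 0" for x
  proof -
    have "(\<Sum>v\<in>range b. (x $ inv b v) *\<^sub>R v) = 0"
      using that assms by (subst sum.reindex) (auto simp: lincomb_def)
    then have "x $ inv b v = 0" if "v \<in> range b" for v
      using assms(2) that unfolding independent_explicit
      by (auto dest: spec[of _ "\<lambda>v. x $ inv b v"])
    then show "x = 0" using assms(1) by (simp add: vec_eq_iff) (metis inv_f_f rangeI)
  qed
  then show ?thesis using linear_injective_0[OF linear_lincomb] by blast
qed

lemma sum_lincomb:
  assumes "bij_betw b UNIV B"
  shows "(\<Sum>v\<in>B. f v *\<^sub>R v) = lincomb b (\<chi> i. f (b i))"
  using sum.reindex_bij_betw[OF assms, of "\<lambda>v. f v *\<^sub>R v"] by (simp add: lincomb_def)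

definition int_cart :: "(real ^ 'n) set"
  where "int_cart = {x. \<forall>i. x $ i \<in> \<int>}"

text \<open>Half-open, so that it both packs and covers modulo \<open>int_cart\<close>.\<close>

definition unit_cell :: "(real ^ 'n) set"
  where "unit_cell = {x. \<forall>i. 0 \<le> x $ i \<and> x $ i < 1}"

lemma countable_int_cart: "countable (int_cart :: (real ^ 'n) set)"
proof -
  have "int_cart = (\<lambda>f. \<chi> i. f i) ` (Pi\<^sub>E UNIV (\<lambda>_. \<int>) :: ('n \<Rightarrow> real) set)"
    by (auto simp: int_cart_def image_iff vec_eq_iff PiE_def Pi_def extensional_def intro!: exI[of _ "vec_nth _"])
  moreover have "countable (\<int> :: real set)"
    unfolding Ints_def by (rule countable_image) simp
  ultimately show ?thesis by (metis countable_PiE countable_image finite_class.finite_UNIV)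
qed

lemma add_subgroup_int_cart: "add_subgroup (int_cart :: (real ^ 'n) set)"
  by (auto simp: add_subgroup_def int_cart_def)

lemma packs_unit_cell: "packs unit_cell (int_cart :: (real ^ 'n) set)"
  unfolding packs_def
proof (intro ballI impI)
  fix x y :: "real ^ 'n"
  assume xy: "x \<in> unit_cell" "y \<in> unit_cell" "x - y \<in> int_cart"
  have "x $ i = y $ i" for i
  proof -
    have "x $ i - y $ i \<in> \<int>" using xy by (simp add: int_cart_def)
    then obtain m :: int where m: "x $ i - y $ i = of_int m" by (auto elim: Ints_cases)
    have "-1 < x $ i - y $ i" "x $ i - y $ i < 1" using xy unfolding unit_cell_def by (smt (verit) mem_Collect_eq)+
    then have "m = 0" unfolding m by linarith
    with m show ?thesis by simp
  qed
  then show "x = y" by (simp add: vec_eq_iff)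
qed

lemma covers_unit_cell: "covers unit_cell (int_cart :: (real ^ 'n) set)"
  unfolding covers_def
proof
  fix x :: "real ^ 'n"
  show "\<exists>u\<in>int_cart. x - u \<in> unit_cell"
    by (rule bexI[of _ "\<chi> i. of_int \<lfloor>x $ i\<rfloor>"]) (auto simp: int_cart_def unit_cell_def, linarith+)
qed

lemma borel_unit_cell: "(unit_cell :: (real ^ 'n) set) \<in> sets borel"
proof -
  have "unit_cell = {x \<in> space borel. \<forall>i. 0 \<le> (x :: real ^ 'n) $ i \<and> x $ i < 1}" by (simp add: unit_cell_def)
  also have "\<dots> \<in> sets borel" by measurable
  finally show ?thesis .
qed

section \<open>The density bound\<close>

text \<open>In the application \<open>P\<close> is a fundamental parallelepiped, so its measure is
  the determinant. The product form avoids division.\<close>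

lemma simplex_lattice_covering_measure:
  fixes g :: "real ^ 'n \<Rightarrow> real ^ 'n"
  assumes n: "CARD('n) \<ge> 3" and g: "linear g" "inj g"
    and L: "countable L" "add_subgroup L" and P: "P \<in> sets borel" "packs P L"
    and T: "T = (\<lambda>x. g x + v) ` std_simplex_cart" "covers T L"
  shows "(1 + 1 / 2 ^ (3 * CARD('n) + 7)) * measure lborel P \<le> measure lborel T"
proof (rule ccontr)
  define n where "n = CARD('n)"
  obtain c where c: "c > 0" and gm: "\<And>A. A \<in> sets borel \<Longrightarrow> g ` A \<in> sets borel"
    and gs: "\<And>A. A \<in> sets borel \<Longrightarrow> emeasure lborel (g ` A) = ennreal c * emeasure lborel A"
    using linear_image_scales_lborel[OF g] by metis
  let ?D = "std_simplex_cart :: (real ^ 'n) set"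
  have D: "?D \<in> sets borel" by (simp add: compact_std_simplex_cart borel_compact)
  have affm: "(\<lambda>x. g x + w) ` A \<in> sets borel"
    and aff: "emeasure lborel ((\<lambda>x. g x + w) ` A) = ennreal c * emeasure lborel A"
    if "A \<in> sets borel" for A w
    using emeasure_lborel_translate[OF gm[OF that], of w] gs[OF that] by (simp_all add: image_image)
  define \<tau> where "\<tau> = c / fact n"
  have \<tau>: "\<tau> > 0" "emeasure lborel T = ennreal \<tau>"
    using c by (simp_all add: T(1) aff D emeasure_std_simplex_cart \<tau>_def n_def flip: ennreal_mult)
  have mT: "measure lborel T = \<tau>" using \<tau> by (simp add: measure_def)
  have Tb: "T \<in> sets borel" by (simp add: T(1) affm D)
  have "compact T"
    unfolding T(1) using g
    by (intro compact_continuous_image continuous_intros linear_continuous_on compact_std_simplex_cart)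
      (simp add: linear_conv_bounded_linear)
  then have bT: "bounded T" by (rule compact_imp_bounded)
  have "emeasure lborel P \<le> ennreal \<tau>"
    using emeasure_packs_le_covers[OF L P(2) T(2) P(1) Tb] \<tau> by simp
  then obtain \<pi> where \<pi>: "\<pi> \<ge> 0" "emeasure lborel P = ennreal \<pi>" "\<pi> \<le> \<tau>"
    using \<tau> by (cases "emeasure lborel P") (auto simp: top_unique)
  then have mP: "measure lborel P = \<pi>" by (simp add: measure_def)
  assume "\<not> ?thesis"
  then have less: "\<tau> < (1 + 1 / 2 ^ (3 * n + 7)) * \<pi>" by (simp add: mT mP n_def)
  \<comment> \<open>The target constant is 1/128 of \<open>(1 / 8) ^ n\<close>. The weaker bound is
    enough, and it is the volume of a copy of \<open>T\<close> scaled by 1/8.\<close>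
  have "(1 / 2 ^ (3 * n + 7)) * \<pi> \<le> (1 / 8) ^ n * \<tau>"
  proof (rule mult_mono)
    have "(1 / 8 :: real) ^ n = 1 / 2 ^ (3 * n)" by (simp add: power_mult power_one_over)
    then show "1 / 2 ^ (3 * n + 7) \<le> (1 / 8 :: real) ^ n" by (simp add: power_add field_simps)
  qed (use \<pi> in auto)
  with less have gap: "\<tau> - \<pi> < (1 / 8) ^ n * \<tau>" by (simp add: algebra_simps)
  \<comment> \<open>What remains of \<open>T\<close> after removing \<open>T + u\<close> still
    covers, so its volume is at least \<open>\<pi>\<close>.\<close>
  have overlap: "emeasure lborel (T \<inter> (\<lambda>x. x + u) ` T) \<le> ennreal (\<tau> - \<pi>)" if u: "u \<in> L" "u \<noteq> 0" for u
  proof -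
    let ?U = "(\<lambda>x. x + u) ` T"
    have U: "?U \<in> sets borel" by (rule emeasure_lborel_translate[OF Tb])
    have fin: "emeasure lborel (T \<inter> ?U) \<le> ennreal \<tau>"
      using Tb U by (subst \<tau>(2)[symmetric], intro emeasure_mono) auto
    then obtain w where w: "w \<ge> 0" "emeasure lborel (T \<inter> ?U) = ennreal w"
      by (cases "emeasure lborel (T \<inter> ?U)") (auto simp: top_unique)
    have "ennreal \<pi> \<le> emeasure lborel (T - ?U)"
      using emeasure_packs_le_covers[OF L P(2) covers_minus_translate[OF L(2) T(2) bT u] P(1)] Tb U \<pi> by simp
    also have "emeasure lborel (T - ?U) = ennreal \<tau> - ennreal w"
      using emeasure_Diff[of lborel "T \<inter> ?U" T] Tb U w \<tau> by (simp add: Diff_Int_distrib Diff_Int)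
    also have "\<dots> = ennreal (\<tau> - w)" using w by (simp add: ennreal_minus)
    finally have "w \<le> \<tau> - \<pi>" using \<pi> by (simp add: ennreal_le_iff2) (use w fin \<tau> in auto)
    then show ?thesis using w by (simp add: ennreal_leI)
  qed
  \<comment> \<open>Here 7/8 is 1 - 1/8: a nonzero such \<open>g x\<close> would make
    \<open>T\<close> and its translate share a copy of \<open>T\<close> scaled by 1/8, which exceeds
    the overlap allowed by \<open>gap\<close>.\<close>
  have small: "x = 0" if x: "g x \<in> L" "pos_sum x \<le> 7 / 8" "pos_sum (- x) \<le> 7 / 8" for x
  proof (rule ccontr)
    assume "x \<noteq> 0"
    then have "g x \<noteq> 0" using g linear_injective_0 by blast
    let ?p = "\<chi> i. max 0 (x $ i)"
    let ?S = "(\<lambda>z. (1 / 8) *\<^sub>R z + ?p) ` ?D"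
    have S: "?S \<in> sets borel"
      by (intro borel_compact compact_continuous_image continuous_intros compact_std_simplex_cart)
    have "emeasure lebesgue ?S = ennreal (\<bar>1 / 8\<bar> ^ DIM(real ^ 'n)) * emeasure lebesgue ?D"
      by (rule emeasure_lebesgue_affine)
    then have eS: "emeasure lborel ?S = ennreal ((1 / 8) ^ n * (1 / fact n))"
      using S D by (simp add: emeasure_std_simplex_cart n_def flip: ennreal_mult)
    have "(\<lambda>y. g y + v) ` ?S \<subseteq> T \<inter> (\<lambda>y. y + g x) ` T"
    proof
      fix w assume "w \<in> (\<lambda>y. g y + v) ` ?S"
      then obtain y z where w: "w = g y + v" and z: "z \<in> ?D" and y_def: "y = (1 / 8) *\<^sub>R z + ?p"
        by blast
      have y: "y \<in> ?D" "y - x \<in> ?D"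
        using std_simplex_cart_translate_inter[of x "1/8" z] x z by (simp_all add: y_def add.commute)
      then have "g y + v \<in> T" by (simp add: T(1))
      moreover have "g (y - x) + v \<in> T" using y by (simp add: T(1))
      then have "g y + v \<in> (\<lambda>y. y + g x) ` T"
        by (rule rev_image_eqI) (simp add: linear_diff[OF g(1)])
      ultimately show "w \<in> T \<inter> (\<lambda>y. y + g x) ` T" by (simp add: w)
    qed
    then have "emeasure lborel ((\<lambda>y. g y + v) ` ?S) \<le> emeasure lborel (T \<inter> (\<lambda>y. y + g x) ` T)"
      using Tb emeasure_lborel_translate(1)[OF Tb] by (intro emeasure_mono) auto
    also have "\<dots> \<le> ennreal (\<tau> - \<pi>)" using overlap x(1) \<open>g x \<noteq> 0\<close> by blast
    finally have "ennreal ((1 / 8) ^ n * \<tau>) \<le> ennreal (\<tau> - \<pi>)"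
      using c by (simp add: aff S eS \<tau>_def mult_ac flip: ennreal_mult)
    then have "(1 / 8) ^ n * \<tau> \<le> \<tau> - \<pi>" using \<pi> by simp
    with gap show False by simp
  qed
  \<comment> \<open>The radius is half of 7/8, so that differences of two points of
    \<open>?B\<close> fall under \<open>small\<close>.\<close>
  let ?B = "diff_body (7 / 16) :: (real ^ 'n) set"
  have B: "?B \<in> sets borel" by (simp add: closed_diff_body)
  have "packs (g ` ?B) L"
    unfolding packs_def
  proof (intro ballI impI, elim imageE)
    fix a b x y
    assume ab: "a - b \<in> L" "a = g x" "b = g y" "x \<in> ?B" "y \<in> ?B"
    have "x - y = 0"
    proof (rule small)
      show "g (x - y) \<in> L" using ab by (simp add: linear_diff[OF g(1)])
      show "pos_sum (x - y) \<le> 7 / 8" "pos_sum (- (x - y)) \<le> 7 / 8"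
        using ab pos_sum_add_le[of x "- y"] pos_sum_add_le[of "- x" y] by (auto simp: diff_body_def)
    qed
    then show "a = b" using ab by simp
  qed
  then have "emeasure lborel (g ` ?B) \<le> ennreal \<tau>"
    using emeasure_packs_le_covers[OF L _ T(2) gm[OF B] Tb] \<tau> by simp
  \<comment> \<open>The scaling factor \<open>c\<close> and \<open>fact n\<close> occur in both
    volumes and cancel, leaving only the binomial inequality.\<close>
  then have "ennreal (c * ((7 / 16) ^ n * real (2 * n choose n) / fact n)) \<le> ennreal \<tau>"
    using c by (simp add: gs B emeasure_diff_body n_def flip: ennreal_mult)
  then have "c * ((7 / 16) ^ n * real (2 * n choose n) / fact n) \<le> c / fact n"
    using \<tau> by (simp add: \<tau>_def)
  then have "(7 / 16) ^ n * real (2 * n choose n) \<le> 1"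
    using c by (simp add: field_simps)
  with central_binomial_bound[of n] n show False by (simp add: n_def)
qed

section \<open>Reduction of simplices and lattices to standard coordinates\<close>

text \<open>Moving one vertex to the origin turns the remaining vertices into a basis, and
  \<open>g\<close> sends the standard basis to it.\<close>

lemma unit_regular_simplex_affine_image:
  fixes T :: "(real ^ 'n) set"
  assumes "is_unit_regular_simplex T"
  obtains g :: "real ^ 'n \<Rightarrow> real ^ 'n" and v
  where "linear g" "inj g" "T = (\<lambda>x. g x + v) ` std_simplex_cart"
proof -
  obtain C where C: "\<not> affine_dependent C" "card C = CARD('n) + 1" "T = convex hull C"
    using assms by (auto simp: is_unit_regular_simplex_def)
  then have "finite C" "C \<noteq> {}" by (auto intro: card_ge_0_finite)
  then obtain v where v: "v \<in> C" by blast
  define B where "B = (\<lambda>x. - v + x) ` (C - {v})"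
  have ind: "independent B"
    using affine_dependent_iff_dependent2[OF v] C(1) by (simp add: B_def)
  have "card B = CARD('n)"
    using C(2) v \<open>finite C\<close> by (simp add: B_def card_image)
  moreover have "finite B" using \<open>finite C\<close> by (simp add: B_def)
  ultimately obtain b :: "'n \<Rightarrow> real ^ 'n" where b: "bij_betw b UNIV B"
    by (metis finite_same_card_bij finite_class.finite_UNIV)
  have rb: "range b = B" "inj b" using b by (auto simp: bij_betw_def)
  have "C = insert v ((\<lambda>x. x + v) ` B)"
    using v by (auto simp: B_def image_image)
  also have "\<dots> = (\<lambda>x. x + v) ` insert 0 B" by simp
  also have "insert 0 B = lincomb b ` insert 0 Basis"
    using linear_0[OF linear_lincomb, of b] by (simp add: Basis_cart_eq image_image lincomb_axis rb)
  finally have Ceq: "C = (\<lambda>x. x + v) ` lincomb b ` insert 0 Basis" .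
  have "T = (\<lambda>x. v + x) ` (convex hull (lincomb b ` insert 0 Basis))"
    unfolding C(3) Ceq convex_hull_translation[symmetric] by (simp add: add.commute)
  also have "convex hull (lincomb b ` insert 0 Basis) = lincomb b ` std_simplex_cart"
    by (simp only: convex_hull_linear_image[OF linear_lincomb] std_simplex_cart_eq)
  finally have "T = (\<lambda>x. lincomb b x + v) ` std_simplex_cart"
    by (simp add: image_image add.commute)
  then show thesis using that linear_lincomb inj_lincomb[of b] rb ind by blast
qed

lemma int_combinations_eq:
  assumes b: "bij_betw b UNIV B"
  shows "{(\<Sum>v\<in>B. of_int (z v) *\<^sub>R v) | z :: real ^ 'n \<Rightarrow> int. True} = lincomb b ` int_cart"
proof (intro equalityI subsetI)
  fix x assume "x \<in> lincomb b ` int_cart"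
  then obtain y where y: "x = lincomb b y" "y \<in> int_cart" by blast
  \<comment> \<open>The entries of \<open>y\<close> are integers already; the floor only changes
    their type.\<close>
  define z where "z v = \<lfloor>y $ inv b v\<rfloor>" for v
  have "of_int (z (b i)) = y $ i" for i
    using y(2) bij_betw_imp_inj_on[OF b] by (auto simp: z_def int_cart_def)
  then have "y = (\<chi> i. of_int (z (b i)))" by (simp add: vec_eq_iff)
  then show "x \<in> {(\<Sum>v\<in>B. of_int (z v) *\<^sub>R v) | z :: real ^ 'n \<Rightarrow> int. True}"
    unfolding y(1) sum_lincomb[OF b] by blast
qed (auto simp: sum_lincomb[OF b] int_cart_def)

text \<open>One linear map straightens the lattice and the cell of the given basis simultaneously,
  so packing facts about \<open>unit_cell\<close> transfer to the parallelepiped.\<close>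

lemma lattice_basis_coordinates:
  fixes B L :: "(real ^ 'n) set"
  assumes "lattice_basis B L"
  obtains h :: "real ^ 'n \<Rightarrow> real ^ 'n" where "linear h" "inj h" "L = h ` int_cart"
    "fundamental_parallelepiped B = h ` unit_cell"
proof -
  have B: "independent B" "card B = CARD('n)"
    and L: "L = {(\<Sum>b\<in>B. of_int (z b) *\<^sub>R b) | z :: real ^ 'n \<Rightarrow> int. True}"
    using assms by (auto simp: lattice_basis_def)
  have "finite B" using B by (intro card_ge_0_finite) simp
  then obtain b :: "'n \<Rightarrow> real ^ 'n" where b: "bij_betw b UNIV B"
    using B by (metis finite_same_card_bij finite_class.finite_UNIV)
  have rb: "range b = B" "inj b" using b by (auto simp: bij_betw_def)
  have "L = lincomb b ` int_cart"
    unfolding L by (rule int_combinations_eq[OF b])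
  moreover have "fundamental_parallelepiped B = lincomb b ` unit_cell"
  proof (intro equalityI subsetI)
    fix x assume "x \<in> lincomb b ` unit_cell"
    then obtain y where y: "x = lincomb b y" "y \<in> unit_cell" by blast
    define t where "t v = y $ inv b v" for v
    have t: "t (b i) = y $ i" for i using rb(2) by (simp add: t_def)
    then have "y = (\<chi> i. t (b i))" by (simp add: vec_eq_iff)
    moreover have "\<forall>v\<in>B. 0 \<le> t v \<and> t v < 1"
      using y(2) t unfolding rb(1)[symmetric] by (auto simp: unit_cell_def)
    ultimately show "x \<in> fundamental_parallelepiped B"
      unfolding fundamental_parallelepiped_def y(1) sum_lincomb[OF b] by blast
  next
    fix x assume "x \<in> fundamental_parallelepiped B"
    then obtain t where t: "x = lincomb b (\<chi> i. t (b i))" "\<forall>v\<in>B. 0 \<le> t v \<and> t v < 1"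
      by (auto simp: fundamental_parallelepiped_def sum_lincomb[OF b])
    have "(\<chi> i. t (b i)) \<in> unit_cell" using t(2) rb by (auto simp: unit_cell_def)
    then show "x \<in> lincomb b ` unit_cell" using t(1) by blast
  qed
  ultimately show thesis using that linear_lincomb inj_lincomb[of b] rb B by blast
qed

lemma lattice_basis_lincomb:
  fixes b :: "'n \<Rightarrow> real ^ 'n"
  assumes "inj b" "independent (range b)"
  shows "lattice_basis (range b) (lincomb b ` int_cart)"
  using assms int_combinations_eq[of b "range b"]
  by (simp add: lattice_basis_def card_image bij_betw_def)

text \<open>The cell contains the open unit cube. With boundedness this makes the determinant a
  positive real, so the density can be multiplied out.\<close>

lemma emeasure_unit_cell_pos: "emeasure lborel (unit_cell :: (real ^ 'n) set) > 0"
proof -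
  have "box (0 :: real ^ 'n) One \<subseteq> unit_cell"
  proof
    fix x :: "real ^ 'n" assume x: "x \<in> box 0 One"
    have "0 < x $ i \<and> x $ i < 1" for i
    proof -
      have "axis i (1::real) \<in> Basis" by (simp add: axis_in_Basis_iff)
      with x have "0 < x \<bullet> axis i 1 \<and> x \<bullet> axis i 1 < 1" by (force simp: mem_box)
      then show ?thesis by (simp add: inner_axis)
    qed
    then show "x \<in> unit_cell" by (auto simp: unit_cell_def less_imp_le)
  qed
  then have "emeasure lborel (box (0 :: real ^ 'n) One) \<le> emeasure lborel (unit_cell :: (real ^ 'n) set)"
    using borel_unit_cell by (intro emeasure_mono) auto
  moreover have "emeasure lborel (box (0 :: real ^ 'n) One) = 1"
    by (subst emeasure_lborel_box) auto
  ultimately show ?thesis by (metis less_le_trans zero_less_one)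
qed

lemma bounded_unit_cell: "bounded (unit_cell :: (real ^ 'n) set)"
proof (rule bounded_subset[OF bounded_cbox[of 0 One]], rule subsetI)
  fix x :: "real ^ 'n" assume x: "x \<in> unit_cell"
  show "x \<in> cbox 0 One"
    unfolding mem_box
  proof
    fix i :: "real ^ 'n" assume i: "i \<in> Basis"
    then obtain j where "i = axis j 1" by (auto simp: Basis_cart_eq)
    then have "x \<bullet> i = x $ j" by (simp add: inner_axis)
    with x i show "0 \<bullet> i \<le> x \<bullet> i \<and> x \<bullet> i \<le> One \<bullet> i"
      by (auto simp: unit_cell_def less_imp_le)
  qed
qed

text \<open>The infimum defining the density must range over a nonempty set. The standard simplex
  contains the cube of side 1/n at the origin, so the image under \<open>g\<close> of the integer
  lattice scaled by 1/n gives a covering.\<close>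

lemma simplex_has_lattice_covering:
  fixes g :: "real ^ 'n \<Rightarrow> real ^ 'n"
  assumes g: "linear g" "inj g" and T: "T = (\<lambda>x. g x + v) ` std_simplex_cart"
  shows "\<exists>L. is_lattice_covering T L"
proof -
  define n where "n = real CARD('n)"
  have n: "n > 0" by (simp add: n_def)
  define h where "h x = g ((1 / n) *\<^sub>R x)" for x
  have h: "linear h" "inj h"
  proof -
    show "linear h" unfolding h_def using g(1) by (intro linearI) (simp_all add: linear_add linear_cmul algebra_simps)
    show "inj h" using n by (auto simp: h_def intro!: injI dest!: injD[OF g(2)])
  qed
  define b where "b i = h (axis i 1)" for i
  have hb: "h = lincomb b"
  proof
    fix x
    have "h x = h (\<Sum>i\<in>UNIV. x $ i *\<^sub>R axis i 1)" by (simp add: basis_expansion scalar_mult_eq_scaleR[symmetric])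
    also have "\<dots> = lincomb b x" by (simp add: linear_sum[OF h(1)] linear_cmul[OF h(1)] lincomb_def b_def)
    finally show "h x = lincomb b x" .
  qed
  have "inj b" using h(2) by (auto simp: b_def inj_on_def axis_eq_axis dest!: injD[OF h(2)])
  have "range b = h ` Basis" by (auto simp: Basis_cart_eq b_def)
  then have "independent (range b)"
    using independent_Basis h by (metis linear_independent_injective_image inj_on_subset subset_UNIV)
  with \<open>inj b\<close> have "is_lattice (h ` int_cart)"
    unfolding hb is_lattice_def using lattice_basis_lincomb by blast
  moreover have "x \<in> (\<Union>u\<in>h ` int_cart. (\<lambda>x. x + u) ` T)" for x
  proof -
    have "surj h" using h linear_injective_imp_surjective by blast
    then obtain y where y: "x - v = h y" by (metis surjD)
    obtain u where u: "u \<in> int_cart" "y - u \<in> unit_cell"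
      using covers_unit_cell unfolding covers_def by blast
    \<comment> \<open>A point of the unit cell has coordinate sum at most n; after division by n it
      satisfies the simplex inequality.\<close>
    have "(\<Sum>i\<in>UNIV. (y - u) $ i) \<le> (\<Sum>i\<in>(UNIV :: 'n set). 1)"
      using u(2) by (intro sum_mono) (auto simp: unit_cell_def less_imp_le)
    then have "(1 / n) *\<^sub>R (y - u) \<in> std_simplex_cart"
      using u(2) n by (auto simp: std_simplex_cart_def unit_cell_def n_def sum_divide_distrib[symmetric])
    then have "h (y - u) + v \<in> T" by (auto simp: T h_def)
    moreover have "x = h (y - u) + v + h u" using y by (simp add: linear_diff[OF h(1)] algebra_simps)
    ultimately show ?thesis using u(1) by blast
  qed
  then have "(\<Union>u\<in>h ` int_cart. (\<lambda>x. x + u) ` T) = UNIV"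
    by (intro equalityI subset_UNIV subsetI)
  ultimately show ?thesis unfolding is_lattice_covering_def by (intro exI conjI)
qed

theorem theorem2:
  fixes T :: "(real ^ 'n) set"
  assumes "CARD('n) \<ge> 3"
    and "is_unit_regular_simplex T"
  shows "lattice_covering_density T \<ge> 1 + 1 / 2 ^ (3 * CARD('n) + 7)"
proof -
  obtain g :: "real ^ 'n \<Rightarrow> real ^ 'n" and v
    where g: "linear g" "inj g" and T: "T = (\<lambda>x. g x + v) ` std_simplex_cart"
    using unit_regular_simplex_affine_image[OF assms(2)] by metis
  have "compact T"
    unfolding T using g
    by (intro compact_continuous_image continuous_intros linear_continuous_on compact_std_simplex_cart)
      (simp add: linear_conv_bounded_linear)
  then have Tb: "T \<in> sets borel" by (rule borel_compact)
  have bound: "1 + 1 / 2 ^ (3 * CARD('n) + 7) \<le> measure lebesgue T / lattice_det L"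
    if "is_lattice_covering T L" for L
  proof -
    \<comment> \<open>The estimate holds for the cell of any basis, so it is enough that the chosen
      one is a basis.\<close>
    define B where "B = (SOME B. lattice_basis B L)"
    have "lattice_basis B L"
      using that unfolding B_def is_lattice_covering_def is_lattice_def by (auto intro: someI_ex)
    then obtain h :: "real ^ 'n \<Rightarrow> real ^ 'n" where h: "linear h" "inj h" "L = h ` int_cart"
      "fundamental_parallelepiped B = h ` unit_cell"
      by (rule lattice_basis_coordinates)
    obtain c where c: "c > 0" "\<And>A. A \<in> sets borel \<Longrightarrow> h ` A \<in> sets borel"
      "\<And>A. A \<in> sets borel \<Longrightarrow> emeasure lborel (h ` A) = ennreal c * emeasure lborel A"
      using linear_image_scales_lborel[OF h(1,2)] by metis
    let ?P = "h ` unit_cell"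
    have Pb: "?P \<in> sets borel" by (simp add: c(2) borel_unit_cell)
    have L: "countable L" "add_subgroup L" "packs ?P L"
      unfolding h(3) using h
      by (auto intro: countable_int_cart add_subgroup_image add_subgroup_int_cart packs_image packs_unit_cell)
    have "\<exists>u\<in>L. x - u \<in> T" for x
    proof -
      have "x \<in> (\<Union>u\<in>L. (\<lambda>x. x + u) ` T)" using that by (simp add: is_lattice_covering_def)
      then obtain u t where "u \<in> L" "t \<in> T" "x = t + u" by blast
      then show ?thesis by (intro bexI[of _ u]) auto
    qed
    then have cov: "covers T L" by (simp add: covers_def)
    have "bounded ?P"
      using h(1) bounded_unit_cell by (intro bounded_linear_image) (auto simp: linear_conv_bounded_linear)
    then have "emeasure lborel ?P < \<infinity>" by (rule emeasure_bounded_finite)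
    moreover have "emeasure lborel ?P > 0"
      using c(1) emeasure_unit_cell_pos[where 'n = 'n]
      by (simp add: c(3)[OF borel_unit_cell] ennreal_zero_less_mult_iff)
    ultimately have "measure lborel ?P > 0" by (simp add: measure_def enn2real_positive_iff)
    moreover have "lattice_det L = measure lborel ?P"
      using Pb by (simp add: lattice_det_def B_def[symmetric] h(4))
    moreover have "measure lebesgue T = measure lborel T"
      using Tb by simp
    moreover have "(1 + 1 / 2 ^ (3 * CARD('n) + 7)) * measure lborel ?P \<le> measure lborel T"
      using simplex_lattice_covering_measure[OF assms(1) g L(1,2) Pb L(3) T cov] .
    ultimately show ?thesis by (simp add: pos_le_divide_eq)
  qed
  \<comment> \<open>A lower bound for all densities passes to \<open>Inf\<close> on the reals only
    for a nonempty set.\<close>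
  have "lattice_covering_densities T \<noteq> {}"
    using simplex_has_lattice_covering[OF g T] by (auto simp: lattice_covering_densities_def)
  then show ?thesis
    unfolding lattice_covering_density_def
    by (rule cInf_greatest) (auto simp: lattice_covering_densities_def bound)
qed

end
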